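(* Let $I=[0,1]$, let $f_M\colon I\to I$ be the continuous piecewise linear map whose graph is obtained by joining consecutively by line segments the points $(0,0)$, $(1/3,1)$, $(4/9,1/3)$, $(5/9,2/3)$, $(2/3,0)$, $(1,1)$, and let $X_M=\varprojlim(I,f_M)$. For every $x\in X_M$ there exists a thin planar embedding $\nu_x\colon X_M\to\mathbb{R}^2$ such that $\nu_x(x)$ is an accessible point of $\nu_x(X_M)$.
   Context: $\mathbb{N}=\{1,2,\dots\}$. For a continuous map $f\colon I\to I$, the inverse limit is $\varprojlim(I,f)=\{(\xi_0,\xi_1,\xi_2,\ldots)\in I^{\infty}: f(\xi_i)=\xi_{i-1}\text{ for all } i\in\mathbb{N}\}$, with the topology inherited from the product topology on $I^\infty$. A planar embedding of a continuum $X$ (nonempty compact connected metric space) is a map $\nu\colon X\to\mathbb{R}^2$ that is a homeomorphism onto its image $\nu(X)$. It is called thin if for every $\varepsilon>0$ there is a finite collection $\ell_1,\ldots,\ell_n$ of nonempty open connected subsets of $\mathbb{R}^2$, each of diameter less than $\varepsilon$, such that $\ell_i\cap\ell_j\neq\emptyset$ if and only if $|i-j|\le 1$, and $\nu(X)\subset\bigcup_{i=1}^n\ell_i$. For a continuum $Y\subset\mathbb{R}^2$, a point $\xi\in Y$ is accessible if there is an arc $A\subset\mathbb{R}^2$ (a homeomorphic copy of $[0,1]$) with $A\cap Y=\{\xi\}$. *)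

theory Defs
  imports "HOL-Analysis.Analysis"
begin

definition line_thru :: "real \<times> real \<Rightarrow> real \<times> real \<Rightarrow> real \<Rightarrow> real" where
  "line_thru p q t = snd p + (snd q - snd p) / (fst q - fst p) * (t - fst p)"

(* Only the values on the unit interval matter; outside it the first and last line are extended. *)
definition f_M :: "real \<Rightarrow> real" where
  "f_M t =
    (if t \<le> 1/3 then line_thru (0, 0) (1/3, 1) t
     else if t \<le> 4/9 then line_thru (1/3, 1) (4/9, 1/3) t
     else if t \<le> 5/9 then line_thru (4/9, 1/3) (5/9, 2/3) t
     else if t \<le> 2/3 then line_thru (5/9, 2/3) (2/3, 0) t
     else line_thru (2/3, 0) (1, 1) t)"

(* The type nat \<Rightarrow> real carries the product topology, so topological notions relative to
   this set refer to the topology inherited from the product. *)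
definition inverse_limit :: "real set \<Rightarrow> (real \<Rightarrow> real) \<Rightarrow> (nat \<Rightarrow> real) set" where
  "inverse_limit S f = {\<xi>. (\<forall>i. \<xi> i \<in> S) \<and> (\<forall>i\<ge>1. f (\<xi> i) = \<xi> (i - 1))}"

definition X_M :: "(nat \<Rightarrow> real) set" where
  "X_M = inverse_limit {0..1} f_M"

(* Only the values of \<nu> on X matter. *)
definition planar_embedding :: "'a::topological_space set \<Rightarrow> ('a \<Rightarrow> real^2) \<Rightarrow> bool" where
  "planar_embedding X \<nu> \<longleftrightarrow> (\<exists>\<mu>. homeomorphism X (\<nu> ` X) \<nu> \<mu>)"

(* Boundedness of the links is explicit because diameter is a real supremum, which is
   meaningless for unbounded sets. *)
definition thin_planar_embedding :: "'a::topological_space set \<Rightarrow> ('a \<Rightarrow> real^2) \<Rightarrow> bool" where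
  "thin_planar_embedding X \<nu> \<longleftrightarrow> planar_embedding X \<nu> \<and>
    (\<forall>\<epsilon>>0. \<exists>(n::nat) (l :: nat \<Rightarrow> (real^2) set).
       (\<forall>i\<in>{1..n}. l i \<noteq> {} \<and> open (l i) \<and> connected (l i) \<and>
          bounded (l i) \<and> diameter (l i) < \<epsilon>) \<and>
       (\<forall>i\<in>{1..n}. \<forall>j\<in>{1..n}. l i \<inter> l j \<noteq> {} \<longleftrightarrow> \<bar>int i - int j\<bar> \<le> 1) \<and>
       \<nu> ` X \<subseteq> (\<Union>i\<in>{1..n}. l i))"

definition accessible :: "(real^2) set \<Rightarrow> real^2 \<Rightarrow> bool" where
  "accessible Y \<xi> \<longleftrightarrow> \<xi> \<in> Y \<and> (\<exists>A. A homeomorphic {0..1::real} \<and> A \<inter> Y = {\<xi>})"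

end

theory Submission
  imports Defs
begin

text \<open>
  Say that a point \<open>y\<close> is exposed for an interval map \<open>g\<close> if the unit interval on the horizontal axis
  can be put into the plane, arbitrarily close to \<open>t \<mapsto> (g t, 0)\<close>, by a continuous injection of the
  plane that maps the vertical ray above \<open>y\<close> into the vertical ray above \<open>g y\<close>. This is \<open>plane_lift g y\<close>.

  If a compact space is the limit of interval maps \<open>g n\<close>, and at every stage the coordinate of \<open>x\<close> is
  exposed, then the compositions of the injections, taken with rapidly decreasing errors,
  converge to a thin embedding. The rays are mapped into each other, so in the limit a vertical
  segment above the image of \<open>x\<close> meets the continuum only there (\<open>accessible_thin_embedding\<close>).

  A point is exposed for \<open>g\<close> if \<open>g t > g y\<close> for all \<open>t > y\<close> (\<open>plane_lift_above_right\<close>), and exposure is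
  inherited by compositions (\<open>plane_lift_comp\<close>). Factoring a map through a fold then yields many
  more exposed points. For \<open>f_M\<close> all points outside the middle branch, that is outside
  \<open>middle = {4/9<..<5/9}\<close>, are exposed (\<open>plane_lift_f_M\<close>).

  The middle branch is dealt with by changing the inverse system and not the map. There is
  an interval map \<open>s_M\<close> with \<open>f_M \<circ> s_M = f_M \<circ> f_M\<close> which agrees with \<open>f_M\<close> on \<open>middle\<close> and for which all
  points of \<open>middle\<close> are exposed. Replacing \<open>f_M\<close> by \<open>s_M\<close> whenever the coordinate of \<open>x\<close> is in \<open>middle\<close> does not
  change the limit, provided that infinitely many copies of \<open>f_M\<close> survive. If only finitely many
  survive, then all late coordinates of \<open>x\<close> are in \<open>middle\<close>; in that case the limit is written with the
  single bonding map \<open>s_M \<circ> f_M\<close>, for which these coordinates are exposed (\<open>plane_lift_s_M_f_M\<close>).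
\<close>

section \<open>Exposed points of interval maps\<close>

text \<open>
  The ray above \<open>y\<close> is the germ of an access path. Demanding that \<open>\<Psi>\<close> carries it affinely onto
  a terminal part of the ray above \<open>g y\<close> makes the access paths of successive stages nested, and
  keeps the notion stable under composition. By invariance of domain, a continuous injection of
  the plane is an open embedding, which is all that is required of a plane map here.
\<close>

definition plane_lift :: "(real \<Rightarrow> real) \<Rightarrow> real \<Rightarrow> bool" where
  "plane_lift g y \<longleftrightarrow> (\<forall>\<epsilon>>0. \<exists>(\<Psi> :: real \<times> real \<Rightarrow> real \<times> real) c d.
     continuous_on UNIV \<Psi> \<and> inj \<Psi> \<and>
     (\<forall>t\<in>{0..1}. dist (\<Psi> (t, 0)) (g t, 0) \<le> \<epsilon>) \<and>
     c \<ge> 0 \<and> d > 0 \<and> (\<forall>u\<ge>0. \<Psi> (y, u) = (g y, c + d * u)))"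

lemma plane_liftE:
  assumes "plane_lift g y" "\<epsilon> > 0"
  obtains \<Psi> :: "real \<times> real \<Rightarrow> real \<times> real" and c d where
     "continuous_on UNIV \<Psi>" "inj \<Psi>" "\<And>t. t \<in> {0..1} \<Longrightarrow> dist (\<Psi> (t, 0)) (g t, 0) \<le> \<epsilon>"
     "c \<ge> 0" "d > 0" "\<And>u. u \<ge> 0 \<Longrightarrow> \<Psi> (y, u) = (g y, c + d * u)"
proof -
  have "\<exists>(\<Psi> :: real \<times> real \<Rightarrow> real \<times> real) c d.
     continuous_on UNIV \<Psi> \<and> inj \<Psi> \<and>
     (\<forall>t\<in>{0..1}. dist (\<Psi> (t, 0)) (g t, 0) \<le> \<epsilon>) \<and>
     c \<ge> 0 \<and> d > 0 \<and> (\<forall>u\<ge>0. \<Psi> (y, u) = (g y, c + d * u))"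
    using assms(1) unfolding plane_lift_def by (rule allE) (erule mp, rule assms(2))
  then show ?thesis
  proof (elim exE conjE)
    fix \<Psi> :: "real \<times> real \<Rightarrow> real \<times> real" and c d
    assume \<Psi>: "continuous_on UNIV \<Psi>" "inj \<Psi>" "c \<ge> 0" "d > 0"
      and near: "\<forall>t\<in>{0..1}. dist (\<Psi> (t, 0)) (g t, 0) \<le> \<epsilon>"
      and ray: "\<forall>u\<ge>0. \<Psi> (y, u) = (g y, c + d * u)"
    show ?thesis by (rule that[OF \<Psi>(1,2) bspec[OF near] \<Psi>(3,4) ray[rule_format]])
  qed
qed

lemma plane_lift_cong:
  assumes "plane_lift g y" "y \<in> {0..1}" "\<And>t. t \<in> {0..1} \<Longrightarrow> g t = h t"
  shows "plane_lift h y"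
proof -
  have "(\<forall>t\<in>{0..1}. dist (\<Psi> (t, 0)) (g t, 0::real) \<le> \<epsilon>) \<longleftrightarrow>
      (\<forall>t\<in>{0..1}. dist (\<Psi> (t, 0)) (h t, 0) \<le> \<epsilon>)" for \<Psi> :: "real \<times> real \<Rightarrow> real \<times> real" and \<epsilon>
    by (intro ball_cong refl) (simp only: assms(3))
  then show ?thesis using assms(1) unfolding plane_lift_def assms(3)[OF assms(2)] by simp
qed

lemma plane_lift_reflection: "plane_lift (\<lambda>t. 1 - t) y"
  unfolding plane_lift_def
proof (intro allI impI)
  fix \<epsilon> :: real assume "\<epsilon> > 0"
  then show "\<exists>(\<Psi> :: real \<times> real \<Rightarrow> real \<times> real) c d.
     continuous_on UNIV \<Psi> \<and> inj \<Psi> \<and> (\<forall>t\<in>{0..1}. dist (\<Psi> (t, 0)) (1 - t, 0) \<le> \<epsilon>) \<and>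
     c \<ge> 0 \<and> d > 0 \<and> (\<forall>u\<ge>0. \<Psi> (y, u) = (1 - y, c + d * u))"
    by (intro exI[of _ "\<lambda>z. (1 - fst z, snd z)"] exI[of _ 0] exI[of _ 1] conjI continuous_intros)
      (simp_all add: inj_on_def prod_eq_iff)
qed

lemma uniformly_continuous_on_cball:
  fixes f :: "'a::heine_borel \<Rightarrow> 'b::metric_space"
  assumes "continuous_on UNIV f" "e > 0"
  obtains d where "d > 0" "\<And>z z'. z \<in> cball a r \<Longrightarrow> z' \<in> cball a r \<Longrightarrow> dist z z' \<le> d \<Longrightarrow> dist (f z) (f z') \<le> e"
proof -
  have "uniformly_continuous_on (cball a r) f"
    using assms(1) by (intro compact_uniformly_continuous) (auto intro: continuous_on_subset)
  then obtain d where d: "d > 0" "\<forall>z\<in>cball a r. \<forall>z'\<in>cball a r. dist z' z < d \<longrightarrow> dist (f z') (f z) < e"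
    using assms(2) unfolding uniformly_continuous_on_def by blast
  show ?thesis
  proof (rule that[of "d/2"])
    show "d / 2 > 0" using d by simp
  next
    fix z z' assume "z \<in> cball a r" "z' \<in> cball a r" "dist z z' \<le> d/2"
    moreover from this have "dist z z' < d" using d(1) by linarith
    ultimately show "dist (f z) (f z') \<le> e" using d(2) by (simp add: less_imp_le)
  qed
qed

lemma in_cball_5:
  assumes "t \<in> {0..1::real}" "dist z (t, 0) \<le> 1"
  shows "z \<in> cball (0::real\<times>real) 5" "(t, 0) \<in> cball (0::real\<times>real) 5"
proof -
  have *: "dist (t, 0) (0::real\<times>real) \<le> 1"
    using assms(1) by (simp add: dist_norm norm_Pair)
  show "(t, 0) \<in> cball (0::real\<times>real) 5" using * by (simp add: dist_commute)
  show "z \<in> cball (0::real\<times>real) 5"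
    using * assms(2) dist_triangle[of z 0 "(t,0)"] by (simp add: dist_commute)
qed

text \<open>
  The lift of the outer map is chosen first; its uniform continuity on a large ball then says how
  precise the lift of the inner map has to be.
\<close>

lemma plane_lift_comp:
  assumes g: "plane_lift g y" "g ` {0..1} \<subseteq> {0..1}" and h: "plane_lift h (g y)"
  shows "plane_lift (h \<circ> g) y"
  unfolding plane_lift_def
proof (intro allI impI)
  fix \<epsilon> :: real assume e: "\<epsilon> > 0"
  then have "\<epsilon>/2 > 0" by simp
  obtain P1 :: "real \<times> real \<Rightarrow> real \<times> real" and c1 d1 where 1: "continuous_on UNIV P1" "inj P1"
      "\<And>t. t \<in> {0..1} \<Longrightarrow> dist (P1 (t, 0)) (h t, 0) \<le> \<epsilon>/2" "c1 \<ge> 0" "d1 > 0"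
      "\<And>u. u \<ge> 0 \<Longrightarrow> P1 (g y, u) = (h (g y), c1 + d1 * u)"
    by (rule plane_liftE[OF h \<open>\<epsilon>/2 > 0\<close>]) blast
  obtain \<eta> where eta: "\<eta> > 0" "\<And>z z'. z \<in> cball 0 5 \<Longrightarrow> z' \<in> cball 0 5 \<Longrightarrow>
      dist z z' \<le> \<eta> \<Longrightarrow> dist (P1 z) (P1 z') \<le> \<epsilon>/2"
    using uniformly_continuous_on_cball[OF 1(1) \<open>\<epsilon>/2 > 0\<close>] by metis
  then have \<eta>1: "min \<eta> 1 > 0" by simp
  obtain P2 :: "real \<times> real \<Rightarrow> real \<times> real" and c2 d2 where 2: "continuous_on UNIV P2" "inj P2"
      "\<And>t. t \<in> {0..1} \<Longrightarrow> dist (P2 (t, 0)) (g t, 0) \<le> min \<eta> 1" "c2 \<ge> 0" "d2 > 0"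
      "\<And>u. u \<ge> 0 \<Longrightarrow> P2 (y, u) = (g y, c2 + d2 * u)"
    by (rule plane_liftE[OF g(1) \<eta>1]) blast
  have "dist ((P1 \<circ> P2) (t, 0)) ((h \<circ> g) t, 0) \<le> \<epsilon>" if t: "t \<in> {0..1}" for t
  proof -
    have gt: "g t \<in> {0..1}" using g(2) t by blast
    have "dist (P2 (t,0)) (g t, 0) \<le> 1" "dist (P2 (t,0)) (g t, 0) \<le> \<eta>" using 2(3)[OF t] by auto
    then have "dist (P1 (P2 (t,0))) (P1 (g t, 0)) \<le> \<epsilon>/2"
      using eta(2) in_cball_5[OF gt] by blast
    moreover have "dist (P1 (g t, 0)) (h (g t), 0) \<le> \<epsilon>/2" using 1(3) gt by blast
    ultimately show ?thesis
      using dist_triangle[of "P1 (P2 (t,0))" "(h (g t), 0)" "P1 (g t, 0)"] by simp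
  qed
  moreover have "continuous_on UNIV (P1 \<circ> P2)"
    unfolding comp_def by (rule continuous_on_compose2[OF 1(1) 2(1)]) simp
  moreover have "inj (P1 \<circ> P2)" using 1(2) 2(2) by (rule inj_compose)
  moreover have "c1 + d1 * c2 \<ge> 0" "d1 * d2 > 0" using 1 2 by auto
  moreover have "(P1 \<circ> P2) (y, u) = ((h \<circ> g) y, (c1 + d1 * c2) + (d1 * d2) * u)" if "u \<ge> 0" for u
    using 1 2 that by (simp add: algebra_simps)
  ultimately show "\<exists>(\<Psi> :: real \<times> real \<Rightarrow> real \<times> real) c d.
     continuous_on UNIV \<Psi> \<and> inj \<Psi> \<and>
     (\<forall>t\<in>{0..1}. dist (\<Psi> (t, 0)) ((h \<circ> g) t, 0) \<le> \<epsilon>) \<and>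
     c \<ge> 0 \<and> d > 0 \<and> (\<forall>u\<ge>0. \<Psi> (y, u) = ((h \<circ> g) y, c + d * u))" by metis
qed

text \<open>
  If \<open>g T > g y\<close> for all \<open>T > y\<close> then, for each height \<open>T\<close>, this is an increasing homeomorphism of the
  line in the variable \<open>t\<close>. It is prescribed at two points, \<open>T \<mapsto> g T\<close> and, once \<open>T\<close> has passed \<open>y\<close>,
  also \<open>y \<mapsto> g y\<close>; it is linear between them and has slope one outside. At \<open>T = y\<close> the two prescriptions agree. For
  \<open>T \<le> y\<close> only the first one is left, and the last summand vanishes.
\<close>

definition sweep :: "(real \<Rightarrow> real) \<Rightarrow> real \<Rightarrow> real \<Rightarrow> real \<Rightarrow> real" where
  "sweep g y T t = g (min T y) + min (t - min T y) 0 + max (t - T) 0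
     + (g (max T y) - g y) * (max 0 (min (t - y) (max T y - y)) / (max T y - y))"

lemma sweep_ray: "y \<le> T \<Longrightarrow> sweep g y T y = g y"
  by (simp add: sweep_def)

lemma sweep_diag: "sweep g y T T = g T"
  by (cases "T \<le> y") (auto simp: sweep_def min_def max_def)

lemma sweep_strict_mono:
  assumes "\<And>t. t > y \<Longrightarrow> g t > g y" "t < t'"
  shows "sweep g y T t < sweep g y T t'"
proof (cases "T \<le> y")
  case True
  then show ?thesis using assms(2) by (simp add: sweep_def min_def max_def)
next
  case False
  define q where "q = (\<lambda>t. max 0 (min (t - y) (T - y)) / (T - y))"
  have sw: "sweep g y T t = g y + min (t - y) 0 + max (t - T) 0 + (g T - g y) * q t" for t
    using False by (simp add: sweep_def q_def)
  have pos: "g T - g y > 0" using assms(1)[of T] False by simp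
  have qm: "q t \<le> q t'" using assms(2) False by (simp add: q_def divide_right_mono)
  then have qm': "(g T - g y) * q t \<le> (g T - g y) * q t'" using pos by simp
  consider "t < y" | "t' > T" | "y \<le> t" "t' \<le> T" by linarith
  then show ?thesis
  proof cases
    case 3
    then have "q t < q t'" using assms(2) False by (simp add: q_def divide_strict_right_mono)
    then have "(g T - g y) * q t < (g T - g y) * q t'" using pos by simp
    then show ?thesis using 3 assms(2) unfolding sw by linarith
  qed (use qm' assms(2) in \<open>auto simp: sw\<close>)
qed

text \<open>
  The only delicate place is \<open>T = y\<close>, where the quotient jumps; there it is bounded by one and
  multiplied by a factor that tends to zero.
\<close>

lemma continuous_on_sweep:
  assumes "continuous_on UNIV g"
  shows "continuous_on UNIV (\<lambda>z. sweep g y (fst z) (snd z))"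
proof -
  define D where "D = (\<lambda>z::real\<times>real. g (max (fst z) y) - g y)"
  define q where "q = (\<lambda>z. max 0 (min (snd z - y) (max (fst z) y - y)) / (max (fst z) y - y))"
  have gc: "continuous_on UNIV (\<lambda>z. g (h z))" if "continuous_on UNIV h" for h :: "real\<times>real \<Rightarrow> real"
    by (rule continuous_on_compose2[OF assms that]) auto
  have Dc: "continuous_on UNIV D" unfolding D_def by (intro continuous_intros gc)
  have q: "\<bar>q z\<bar> \<le> 1" for z by (auto simp: q_def divide_le_eq)
  have "isCont (\<lambda>z. D z * q z) z" for z
  proof (cases "fst z > y")
    case True
    have "open {z::real\<times>real. fst z > y}" by (intro open_Collect_less continuous_intros)
    moreover have "continuous_on {z::real\<times>real. fst z > y} q"
      unfolding q_def by (intro continuous_intros) auto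
    ultimately have "isCont q z" using True continuous_on_eq_continuous_at by blast
    moreover have "isCont D z" using Dc continuous_on_eq_continuous_at open_UNIV by blast
    ultimately show ?thesis by (intro continuous_intros)
  next
    case False
    then have D0: "D z = 0" by (simp add: D_def)
    have "isCont D z" using Dc continuous_on_eq_continuous_at open_UNIV by blast
    then have "(D \<longlongrightarrow> 0) (at z)" using D0 by (simp add: isCont_def)
    moreover have "eventually (\<lambda>w. norm (D w * q w) \<le> norm (D w) * 1) (at z)"
      using q by (intro always_eventually allI) (simp add: abs_mult mult_left_le)
    ultimately have "((\<lambda>w. D w * q w) \<longlongrightarrow> 0) (at z)"
      by (rule tendsto_0_le)
    then show ?thesis using D0 by (simp add: isCont_def)
  qed
  then have "continuous_on UNIV (\<lambda>z. D z * q z)" by (simp add: continuous_at_imp_continuous_on)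
  then have Dq: "continuous_on UNIV (\<lambda>z. (g (max (fst z) y) - g y) *
      (max 0 (min (snd z - y) (max (fst z) y - y)) / (max (fst z) y - y)))"
    unfolding D_def q_def .
  show ?thesis unfolding sweep_def
    by (rule continuous_on_add[OF _ Dq]) (intro continuous_intros gc)
qed

text \<open>
  The lift is \<open>(t, u) \<mapsto> (sweep g y (t + u) t, \<epsilon> * (t + u))\<close>, a variant of the Henon map. It moves the
  line \<open>t + u = T\<close> to the horizontal line at height \<open>\<epsilon> * T\<close>, on which the arc over \<open>t = T\<close> has to sit at
  \<open>g T\<close> and the ray above \<open>y\<close> at \<open>g y\<close>. The points of that line with \<open>t > y\<close> lie to the right of the
  ray, so this can be done injectively because \<open>g T > g y\<close>.
\<close>

lemma plane_lift_above_right: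
  assumes g: "continuous_on {0..1} g" and y: "y \<in> {0..1}"
    and above: "\<And>t. t \<in> {0..1} \<Longrightarrow> t > y \<Longrightarrow> g t > g y"
  shows "plane_lift g y"
  unfolding plane_lift_def
proof (intro allI impI)
  fix \<epsilon> :: real assume e: "\<epsilon> > 0"
  \<comment> \<open>The sweep needs a map of the whole line, so \<open>g\<close> is continued with slope one to the right of
      the unit interval; this keeps it above \<open>g y\<close> there.\<close>
  define G where "G = (\<lambda>t. g (max 0 (min t 1)) + max (t - 1) 0)"
  have "continuous_on UNIV G" unfolding G_def
    by (intro continuous_intros continuous_on_compose2[OF g]) auto
  then have sc: "continuous_on UNIV (\<lambda>z. sweep G y (fst z) (snd z))" by (rule continuous_on_sweep)
  have G: "G t = g t" if "t \<in> {0..1}" for t using that by (simp add: G_def)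
  have Gab: "G t > G y" if "t > y" for t
  proof (cases "t \<le> 1")
    case True then show ?thesis using that y above[of t] by (simp add: G)
  next
    case False
    moreover have "g 1 \<ge> g y" using above[of 1] y by (cases "y = 1") auto
    ultimately show ?thesis using G[OF y] by (simp add: G_def)
  qed
  define P where "P = (\<lambda>(t, u). (sweep G y (t + u) t, \<epsilon> * (t + u)))"
  have "continuous_on UNIV P" unfolding P_def case_prod_unfold
  proof (intro continuous_on_Pair)
    have "continuous_on UNIV (\<lambda>p::real \<times> real. (fst p + snd p, fst p))"
      by (intro continuous_intros)
    from continuous_on_compose2[OF sc this]
    show "continuous_on UNIV (\<lambda>p. sweep G y (fst p + snd p) (fst p))" by simp
  qed (intro continuous_intros)
  moreover have "inj P"
  proof (rule injI)
    fix z w assume eq: "P z = P w"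
    obtain t u t' u' where zw: "z = (t, u)" "w = (t', u')" by fastforce
    have 1: "t + u = t' + u'" "sweep G y (t + u) t = sweep G y (t + u) t'"
      using eq e by (auto simp: P_def zw)
    then have "t = t'" using sweep_strict_mono[of y G t t'] sweep_strict_mono[of y G t' t] Gab
      by (metis less_irrefl linorder_neqE_linordered_idom)
    then show "z = w" using 1 zw by simp
  qed
  moreover have "\<forall>t\<in>{0..1}. dist (P (t, 0)) (g t, 0) \<le> \<epsilon>"
    using e G by (auto simp: P_def sweep_diag dist_Pair_Pair dist_norm mult_left_le)
  moreover have "\<epsilon> * y \<ge> 0" using e y by simp
  moreover have "\<forall>u\<ge>0. P (y, u) = (g y, \<epsilon> * y + \<epsilon> * u)"
    using y G by (auto simp: P_def sweep_ray algebra_simps)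
  ultimately show "\<exists>(\<Psi> :: real \<times> real \<Rightarrow> real \<times> real) c d.
     continuous_on UNIV \<Psi> \<and> inj \<Psi> \<and>
     (\<forall>t\<in>{0..1}. dist (\<Psi> (t, 0)) (g t, 0) \<le> \<epsilon>) \<and>
     c \<ge> 0 \<and> d > 0 \<and> (\<forall>u\<ge>0. \<Psi> (y, u) = (g y, c + d * u))" using e by blast
qed

lemma plane_lift_conjugate:
  assumes "plane_lift g y" "g ` {0..1} \<subseteq> {0..1}"
  shows "plane_lift (\<lambda>t. 1 - g (1 - t)) (1 - y)"
proof -
  have 1: "plane_lift ((\<lambda>t. 1 - t) \<circ> g) y"
    using plane_lift_comp[OF assms plane_lift_reflection] .
  have "plane_lift (((\<lambda>t. 1 - t) \<circ> g) \<circ> (\<lambda>t. 1 - t)) (1 - y)"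
    by (rule plane_lift_comp[OF plane_lift_reflection]) (use 1 in auto)
  then show ?thesis by (simp add: comp_def)
qed

text \<open>
  Reversing both axes of the graph turns this into the criterion \<open>plane_lift_above_right\<close>.
\<close>

lemma plane_lift_below_left:
  assumes "continuous_on {0..1} g" "g ` {0..1} \<subseteq> {0..1}" "y \<in> {0..1}"
    and "\<And>t. t \<in> {0..1} \<Longrightarrow> t < y \<Longrightarrow> g t < g y"
  shows "plane_lift g y"
proof -
  have "continuous_on {0..1} (\<lambda>t. g (1 - t))"
    by (rule continuous_on_compose2[OF assms(1)]) (auto intro!: continuous_intros)
  then have "continuous_on {0..1} (\<lambda>t. 1 - g (1 - t))" by (intro continuous_intros)
  then have "plane_lift (\<lambda>t. 1 - g (1 - t)) (1 - y)"
    by (rule plane_lift_above_right) (use assms in auto)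
  from plane_lift_conjugate[OF this] show ?thesis
    using assms(2) by (simp add: image_subset_iff)
qed

section \<open>Thin embeddings of inverse limits\<close>

text \<open>
  The composition \<open>\<psi> k \<circ> \<dots> \<circ> \<psi> (n - 1)\<close>. The equation for \<open>n < k\<close> gives the identity, so that the
  empty composition at \<open>n = k\<close> comes out right.
\<close>

primrec tower :: "(nat \<Rightarrow> 'a \<Rightarrow> 'a) \<Rightarrow> nat \<Rightarrow> nat \<Rightarrow> 'a \<Rightarrow> 'a" where
  "tower \<psi> k 0 = id"
| "tower \<psi> k (Suc n) = (if n < k then id else tower \<psi> k n \<circ> \<psi> n)"

lemma tower_refl: "tower \<psi> k k = id"
  by (cases k) auto

lemma tower_trans: "k \<le> n \<Longrightarrow> n \<le> m \<Longrightarrow> tower \<psi> k m = tower \<psi> k n \<circ> tower \<psi> n m"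
proof (induction m)
  case (Suc m)
  then show ?case by (cases "n = Suc m") (auto simp: tower_refl)
qed auto

lemma tower_cong: "(\<And>i. i < n \<Longrightarrow> \<psi> i = \<phi> i) \<Longrightarrow> tower \<psi> k n = tower \<phi> k n"
  by (induction n) auto

lemma continuous_on_tower:
  fixes \<psi> :: "nat \<Rightarrow> 'a::topological_space \<Rightarrow> 'a"
  assumes "\<And>i. i < n \<Longrightarrow> continuous_on UNIV (\<psi> i)"
  shows "continuous_on UNIV (tower \<psi> k n)"
  using assms
proof (induction n)
  case (Suc n)
  have "continuous_on UNIV (\<lambda>x. tower \<psi> k n (\<psi> n x))"
    by (rule continuous_on_compose2[of UNIV]) (use Suc in auto)
  then show ?case by (simp add: comp_def id_def)
qed (simp add: id_def)

lemma inj_tower: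
  assumes "\<And>i. i < n \<Longrightarrow> inj (\<psi> i)"
  shows "inj (tower \<psi> k n)"
  using assms by (induction n) (simp_all add: inj_compose)

lemma over_power_two_tendsto_0: "(\<lambda>n. c / 2 ^ n :: real) \<longlonglongrightarrow> 0"
proof -
  have "(\<lambda>n. c * (1 / 2) ^ n) \<longlonglongrightarrow> 0"
    by (intro tendsto_mult_right_zero LIMSEQ_realpow_zero) auto
  then show ?thesis by (simp add: power_one_over)
qed

text \<open>
  Steps that halve each time converge, with the tail bounded by twice the next step.
\<close>

lemma geometric_steps_limit:
  fixes a :: "nat \<Rightarrow> 'a::complete_space"
  assumes "\<And>n. dist (a (Suc n)) (a n) \<le> C / 2 ^ n"
  shows "\<exists>l. a \<longlonglongrightarrow> l \<and> (\<forall>n. dist (a n) l \<le> 2 * C / 2 ^ n)"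
proof -
  have C: "C \<ge> 0" using order_trans[OF zero_le_dist assms[of 0]] by simp
  have *: "dist (a (n + i)) (a n) \<le> C / 2 ^ n * (2 - 2 / 2 ^ i)" for n i
  proof (induction i)
    case (Suc i)
    have "dist (a (n + Suc i)) (a n) \<le> dist (a (Suc (n + i))) (a (n + i)) + dist (a (n + i)) (a n)"
      using dist_triangle[of "a (Suc (n + i))" "a n" "a (n + i)"] by simp
    also have "\<dots> \<le> C / 2 ^ (n + i) + C / 2 ^ n * (2 - 2 / 2 ^ i)"
      using Suc assms by (intro add_mono)
    also have "\<dots> = C / 2 ^ n * (2 - 2 / 2 ^ Suc i)"
    proof -
      have 1: "C / 2 ^ (n + i) = C / 2 ^ n * (1 / 2 ^ i)" by (simp add: power_add)
      have 2: "2 - 2 / 2 ^ i = 2 - 2 * (1 / 2 ^ i :: real)" by simp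
      have 3: "2 - 2 / 2 ^ Suc i = 2 - (1 / 2 ^ i :: real)" by simp
      have "q * w + q * (2 - 2 * w) = q * (2 - w)" for q w :: real by (simp add: algebra_simps)
      then show ?thesis unfolding 1 2 3 .
    qed
    finally show ?case .
  qed simp
  have le: "dist (a m) (a n) \<le> 2 * C / 2 ^ n" if mn: "m \<ge> n" for m n
  proof -
    obtain i where m: "m = n + i" using le_Suc_ex[OF mn] by blast
    moreover have "C / 2 ^ n * (2 - 2 / 2 ^ i) \<le> C / 2 ^ n * 2"
      by (rule mult_left_mono) (use C in simp_all)
    moreover have "C / 2 ^ n * 2 = 2 * C / 2 ^ n" by simp
    ultimately show ?thesis using *[of n i] unfolding m by linarith
  qed
  have lim0: "(\<lambda>n. 2 * C / 2 ^ n) \<longlonglongrightarrow> 0"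
    by (rule over_power_two_tendsto_0)
  have "Cauchy a"
  proof (rule metric_CauchyI)
    fix e :: real assume "e > 0"
    then have "eventually (\<lambda>n. 2 * C / 2 ^ n < e / 2) sequentially"
      using order_tendstoD(2)[OF lim0, of "e/2"] by simp
    then obtain N where N: "2 * C / 2 ^ N < e / 2" unfolding eventually_sequentially by blast
    have "dist (a m) (a n) < e" if "m \<ge> N" "n \<ge> N" for m n
      using le[OF that(1)] le[OF that(2)] N dist_triangle2[of "a m" "a n" "a N"] by linarith
    then show "\<exists>M. \<forall>m\<ge>M. \<forall>n\<ge>M. dist (a m) (a n) < e" by blast
  qed
  then obtain l where l: "a \<longlonglongrightarrow> l" using Cauchy_convergent[of a] unfolding convergent_def by blast
  moreover have "dist (a n) l \<le> 2 * C / 2 ^ n" for n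
  proof (rule LIMSEQ_le_const2)
    show "(\<lambda>m. dist (a n) (a m)) \<longlonglongrightarrow> dist (a n) l" by (intro tendsto_intros l)
    have "dist (a n) (a m) \<le> 2 * C / 2 ^ n" if "m \<ge> n" for m
      using le[OF that] by (simp only: dist_commute)
    then show "\<exists>N. \<forall>m\<ge>N. dist (a n) (a m) \<le> 2 * C / 2 ^ n" by blast
  qed
  ultimately show ?thesis by blast
qed

text \<open>
  The constructions use coordinate pairs; the target of the embedding is the vector type.
\<close>

definition to_plane :: "real \<times> real \<Rightarrow> real^2" where
  "to_plane z = vector [fst z, snd z]"

lemma to_plane_nth: "to_plane z $ i = (if i = 1 then fst z else snd z)"
  using exhaust_2[of i] by (auto simp: to_plane_def)

lemma continuous_on_to_plane: "continuous_on S to_plane"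
proof -
  have eq: "to_plane = (\<lambda>z. \<chi> i. if i = 1 then fst z else snd z)"
    by (auto simp: vec_eq_iff to_plane_nth)
  show ?thesis unfolding eq
  proof (rule continuous_on_vec_lambda)
    show "continuous_on S (\<lambda>z::real \<times> real. if i = 1 then fst z else snd z)" for i :: 2
      by (cases "i = 1") (auto intro!: continuous_intros)
  qed
qed

lemma inj_to_plane: "inj to_plane"
proof (rule injI)
  fix z w assume "to_plane z = to_plane w"
  then have "to_plane z $ 1 = to_plane w $ 1" "to_plane z $ 2 = to_plane w $ 2" by simp_all
  then show "z = w" by (simp add: to_plane_nth prod_eq_iff)
qed

lemma finite_tolerances:
  fixes P :: "'i \<Rightarrow> real \<Rightarrow> bool"
  assumes "finite I" "\<And>i. i \<in> I \<Longrightarrow> \<exists>r>0. P i r" "\<And>i r s. i \<in> I \<Longrightarrow> P i r \<Longrightarrow> 0 < s \<Longrightarrow> s \<le> r \<Longrightarrow> P i s"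
  shows "\<exists>r>0. \<forall>i\<in>I. P i r"
proof -
  obtain h where h: "\<And>i. i \<in> I \<Longrightarrow> h i > 0 \<and> P i (h i)" using assms(2) by metis
  define r where "r = Min (insert 1 (h ` I))"
  have "r > 0" using h assms(1) by (simp add: r_def)
  moreover have "r \<le> h i" if "i \<in> I" for i using that assms(1) by (simp add: r_def)
  ultimately show ?thesis using h assms(3) by blast
qed

text \<open>
  Closeness of late coordinates controls earlier ones. This is what later turns approximate
  agreement at every stage into equality.
\<close>

lemma bonding_modulus:
  fixes p :: "nat \<Rightarrow> 'a \<Rightarrow> real"
  assumes g: "\<And>n. continuous_on {0..1} (g n)"
    and p: "\<And>n u. u \<in> X \<Longrightarrow> p n u \<in> {0..1}" "\<And>n u. u \<in> X \<Longrightarrow> p n u = g n (p (Suc n) u)"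
    and "k \<le> n" "\<epsilon> > 0"
  shows "\<exists>r>0. \<forall>u\<in>X. \<forall>v\<in>X. \<bar>p n u - p n v\<bar> \<le> r \<longrightarrow> \<bar>p k u - p k v\<bar> \<le> \<epsilon>"
  using \<open>k \<le> n\<close>
proof (induction n rule: dec_induct)
  case base
  then show ?case using \<open>\<epsilon> > 0\<close> by auto
next
  case (step n)
  then obtain r where r: "r > 0" "\<forall>u\<in>X. \<forall>v\<in>X. \<bar>p n u - p n v\<bar> \<le> r \<longrightarrow> \<bar>p k u - p k v\<bar> \<le> \<epsilon>" by blast
  have "uniformly_continuous_on {0..1} (g n)" by (rule compact_uniformly_continuous) (use g in auto)
  then obtain d where d: "d > 0" "\<And>s t. s \<in> {0..1} \<Longrightarrow> t \<in> {0..1} \<Longrightarrow> dist t s < d \<Longrightarrow> dist (g n t) (g n s) < r"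
    using r(1) unfolding uniformly_continuous_on_def by metis
  have "\<bar>p k u - p k v\<bar> \<le> \<epsilon>" if "u \<in> X" "v \<in> X" "\<bar>p (Suc n) u - p (Suc n) v\<bar> \<le> d/2" for u v
  proof -
    have "dist (p (Suc n) u) (p (Suc n) v) < d" using that(3) d(1) unfolding dist_real_def by linarith
    then have "dist (g n (p (Suc n) u)) (g n (p (Suc n) v)) < r" using d(2) p(1) that by blast
    then show ?thesis using r(2) that p(2)[of _ n] by (simp add: dist_real_def)
  qed
  then have "\<forall>u\<in>X. \<forall>v\<in>X. \<bar>p (Suc n) u - p (Suc n) v\<bar> \<le> d/2 \<longrightarrow> \<bar>p k u - p k v\<bar> \<le> \<epsilon>"
    by (intro ballI impI)
  moreover have "d / 2 > 0" using d(1) by simp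
  ultimately show ?case by (intro exI[of _ "d/2"] conjI)
qed

text \<open>
  Stage \<open>n\<close> maps \<open>X\<close> to the horizontal axis by \<open>p n\<close> and then to the plane by \<open>\<psi> 0 \<circ> \<dots> \<circ> \<psi> (n - 1)\<close>,
  where \<open>\<psi> n\<close> lifts \<open>g n\<close> with error \<open>\<delta> n\<close>; the embedding \<open>\<nu>\<close> is the limit. If the errors decrease fast
  enough then, seen in the coordinates of stage \<open>n\<close>, the image of every point \<open>u\<close> stays within
  \<open>2 * \<delta> n\<close> of \<open>(p n u, 0)\<close>. Everything follows from this.

  Two points with the same image have nearly equal coordinates at every stage, hence equal ones.
  A row of small overlapping boxes along the axis of stage \<open>n\<close> covers the image, and its transport
  to the plane is a chain of small open connected links. Finally the ray above \<open>p n x\<close> at stage \<open>n\<close>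
  becomes, in the plane, the vertical ray over \<open>p 0 x\<close> starting at height \<open>c n\<close>, and these starting
  points increase to the image of \<open>x\<close>. A point of the image above that of \<open>x\<close> would lie on the ray
  at every stage, so its coordinates would be nearly those of \<open>x\<close>, and it would be the image of \<open>x\<close>.
\<close>

lemma accessible_thin_embedding:
  fixes X :: "'a::topological_space set" and p :: "nat \<Rightarrow> 'a \<Rightarrow> real"
  assumes X: "compact X" and x: "x \<in> X"
    and pc: "\<And>n. continuous_on X (p n)" and p01: "\<And>n u. u \<in> X \<Longrightarrow> p n u \<in> {0..1}"
    and g: "\<And>n. continuous_on {0..1} (g n)" and pg: "\<And>n u. u \<in> X \<Longrightarrow> p n u = g n (p (Suc n) u)"
    and sep: "\<And>u v. u \<in> X \<Longrightarrow> v \<in> X \<Longrightarrow> (\<And>n. p n u = p n v) \<Longrightarrow> u = v"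
    and lift: "\<And>n. plane_lift (g n) (p (Suc n) x)"
  shows "\<exists>\<nu>. thin_planar_embedding X \<nu> \<and> accessible (\<nu> ` X) (\<nu> x)"
proof -
  define y where "y n = p n x" for n
  have y: "y n = g n (y (Suc n))" "y n \<in> {0..1}" for n unfolding y_def using pg[OF x] p01[OF x] by blast+
  \<comment> \<open>A lift of \<open>g n\<close> is fixed for every error, so that only a sequence of errors remains to be found.\<close>
  define L where "L n \<epsilon> q \<longleftrightarrow> (case q of (\<Psi> :: real \<times> real \<Rightarrow> real \<times> real, c, d) \<Rightarrow>
     continuous_on UNIV \<Psi> \<and> inj \<Psi> \<and> (\<forall>t\<in>{0..1}. dist (\<Psi> (t, 0)) (g n t, 0) \<le> \<epsilon>) \<and>
     c \<ge> 0 \<and> d > 0 \<and> (\<forall>u\<ge>0. \<Psi> (y (Suc n), u) = (y n, c + d * u)))" for n and \<epsilon> :: real and q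
  have exL: "\<exists>q. L n \<epsilon> q" if "\<epsilon> > 0" for n and \<epsilon> :: real
    using lift[of n] that unfolding plane_lift_def L_def by (simp flip: y_def y(1))
  have L: "L n \<epsilon> (SOME q. L n \<epsilon> q)" if "\<epsilon> > 0" for n and \<epsilon> :: real
    by (rule someI_ex[OF exL[OF that]])
  define \<Psi> where "\<Psi> n \<epsilon> = fst (SOME q. L n \<epsilon> q)" for n \<epsilon>
  define C where "C n \<epsilon> = fst (snd (SOME q. L n \<epsilon> q))" for n \<epsilon>
  define D where "D n \<epsilon> = snd (snd (SOME q. L n \<epsilon> q))" for n \<epsilon>
  have \<Psi>: "continuous_on UNIV (\<Psi> n \<epsilon>)" "inj (\<Psi> n \<epsilon>)"
      "t \<in> {0..1} \<Longrightarrow> dist (\<Psi> n \<epsilon> (t, 0)) (g n t, 0) \<le> \<epsilon>"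
      "C n \<epsilon> \<ge> 0" "D n \<epsilon> > 0"
      "u \<ge> 0 \<Longrightarrow> \<Psi> n \<epsilon> (y (Suc n), u) = (y n, C n \<epsilon> + D n \<epsilon> * u)"
    if "\<epsilon> > 0" for n \<epsilon> t u
    using L[OF that, of n] unfolding L_def \<Psi>_def C_def D_def case_prod_unfold by blast+
  define T where "T \<delta> = tower (\<lambda>n. \<Psi> n (\<delta> n))" for \<delta>
  define B where "B = cball (0::real \<times> real) 20"
  \<comment> \<open>The three requirements on the error \<open>r\<close> at stage \<open>n\<close>: it separates points, it makes the links of
      stage \<open>n\<close> small (boxes below have size at most \<open>8 * r\<close>), and it disturbs the earlier stage \<open>k\<close> by an
      amount that can be summed to at most \<open>2 * \<delta> k\<close>.\<close>
  define close :: "(nat \<Rightarrow> real) \<Rightarrow> nat \<Rightarrow> nat \<Rightarrow> real \<Rightarrow> bool" where "close \<delta> n k r \<longleftrightarrow>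
      (\<forall>u\<in>X. \<forall>v\<in>X. \<bar>p n u - p n v\<bar> \<le> 4 * r \<longrightarrow> \<bar>p k u - p k v\<bar> \<le> 1 / 2 ^ n) \<and>
      (\<forall>z\<in>B. \<forall>z'\<in>B. dist z z' \<le> 8 * r \<longrightarrow> dist (to_plane (T \<delta> 0 n z)) (to_plane (T \<delta> 0 n z')) \<le> 1 / 2 ^ n) \<and>
      (k < n \<longrightarrow> (\<forall>z\<in>B. \<forall>z'\<in>B. dist z z' \<le> r \<longrightarrow> dist (T \<delta> k n z) (T \<delta> k n z') \<le> \<delta> k / 2 ^ (n - k)))"
    for \<delta> n k r
  define P where "P \<delta> n r \<longleftrightarrow> 0 < r \<and> r \<le> 1 \<and> (\<forall>k\<le>n. close \<delta> n k r)" for \<delta> n r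
  have "\<exists>\<delta>. \<forall>n. P \<delta> n (\<delta> n)"
  proof (rule dependent_wellorder_choice)
    fix r \<delta> \<delta>' and n :: nat assume eq: "\<And>m. m < n \<Longrightarrow> \<delta> m = (\<delta>' m :: real)"
    then have "T \<delta> k n = T \<delta>' k n" for k unfolding T_def by (intro tower_cong) simp
    then show "P \<delta> n r = P \<delta>' n r" using eq by (simp add: P_def close_def cong: conj_cong imp_cong)
  next
    fix n and \<delta> :: "nat \<Rightarrow> real" assume P: "\<And>m. m < n \<Longrightarrow> P \<delta> m (\<delta> m)"
    then have pos: "\<delta> m > 0" if "m < n" for m using that by (simp add: P_def)
    have Tc: "continuous_on UNIV (T \<delta> k n)" for k
      unfolding T_def using pos \<Psi>(1) by (intro continuous_on_tower) auto
    have Tc': "continuous_on UNIV (\<lambda>z. to_plane (T \<delta> k n z))" for k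
      by (rule continuous_on_compose2[OF continuous_on_to_plane Tc]) auto
    have "\<exists>r>0. close \<delta> n k r" if k: "k \<le> n" for k
    proof -
      have e: "(1::real) / 2 ^ n > 0" by simp
      obtain r1 where r1: "r1 > 0" "\<forall>u\<in>X. \<forall>v\<in>X. \<bar>p n u - p n v\<bar> \<le> r1 \<longrightarrow> \<bar>p k u - p k v\<bar> \<le> 1 / 2 ^ n"
        using bonding_modulus[where p = p and X = X, OF g p01 pg k e] by blast
      obtain r2 where r2: "r2 > 0" "\<And>z z'. z \<in> B \<Longrightarrow> z' \<in> B \<Longrightarrow> dist z z' \<le> r2 \<Longrightarrow>
          dist (to_plane (T \<delta> 0 n z)) (to_plane (T \<delta> 0 n z')) \<le> 1 / 2 ^ n"
        using uniformly_continuous_on_cball[OF Tc' e, of 0 20 0] unfolding B_def by blast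
      obtain r3 where r3: "r3 > 0" "k < n \<Longrightarrow> (\<forall>z\<in>B. \<forall>z'\<in>B. dist z z' \<le> r3 \<longrightarrow>
          dist (T \<delta> k n z) (T \<delta> k n z') \<le> \<delta> k / 2 ^ (n - k))"
      proof (cases "k < n")
        case True
        then have "\<delta> k / 2 ^ (n - k) > 0" using pos by simp
        from uniformly_continuous_on_cball[OF Tc this, of 0 20 k]
        obtain d where "d > 0" and d: "\<And>z z'. z \<in> B \<Longrightarrow> z' \<in> B \<Longrightarrow> dist z z' \<le> d \<Longrightarrow>
            dist (T \<delta> k n z) (T \<delta> k n z') \<le> \<delta> k / 2 ^ (n - k)"
          unfolding B_def by blast
        show ?thesis by (rule that[of d, OF \<open>d > 0\<close>]) (intro ballI impI d)
      qed (use that[of 1] in auto)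
      define r where "r = min (r1/4) (min (r2/8) r3)"
      have r: "r > 0" "4 * r \<le> r1" "8 * r \<le> r2" "r \<le> r3" using r1 r2 r3 by (auto simp: r_def)
      have "close \<delta> n k r" unfolding close_def
      proof (intro conjI ballI impI)
        show "\<bar>p k u - p k v\<bar> \<le> 1 / 2 ^ n" if "u \<in> X" "v \<in> X" "\<bar>p n u - p n v\<bar> \<le> 4 * r" for u v
          using r1(2) that order_trans[OF that(3) r(2)] by blast
        show "dist (to_plane (T \<delta> 0 n z)) (to_plane (T \<delta> 0 n z')) \<le> 1 / 2 ^ n"
          if "z \<in> B" "z' \<in> B" "dist z z' \<le> 8 * r" for z z'
          using r2(2) that order_trans[OF that(3) r(3)] by blast
        show "dist (T \<delta> k n z) (T \<delta> k n z') \<le> \<delta> k / 2 ^ (n - k)"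
          if "k < n" "z \<in> B" "z' \<in> B" "dist z z' \<le> r" for z z'
          using r3(2) that order_trans[OF that(4) r(4)] by blast
      qed
      then show ?thesis using \<open>r > 0\<close> by blast
    qed
    then have ex: "\<exists>r>0. close \<delta> n k r" if "k \<in> {..n}" for k using that by simp
    have mono: "close \<delta> n k s" if c: "close \<delta> n k r" and "0 < s" "s \<le> r" for k r s
    proof -
      have r: "4 * s \<le> 4 * r" "8 * s \<le> 8 * r" "s \<le> r" using that by auto
      show ?thesis unfolding close_def
      proof (intro conjI ballI impI)
        show "\<bar>p k u - p k v\<bar> \<le> 1 / 2 ^ n" if "u \<in> X" "v \<in> X" "\<bar>p n u - p n v\<bar> \<le> 4 * s" for u v
          using c that order_trans[OF that(3) r(1)] unfolding close_def by blast
        show "dist (to_plane (T \<delta> 0 n z)) (to_plane (T \<delta> 0 n z')) \<le> 1 / 2 ^ n"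
          if "z \<in> B" "z' \<in> B" "dist z z' \<le> 8 * s" for z z'
          using c that order_trans[OF that(3) r(2)] unfolding close_def by blast
        show "dist (T \<delta> k n z) (T \<delta> k n z') \<le> \<delta> k / 2 ^ (n - k)"
          if "k < n" "z \<in> B" "z' \<in> B" "dist z z' \<le> s" for z z'
          using c that order_trans[OF that(4) r(3)] unfolding close_def by blast
      qed
    qed
    have "\<exists>r>0. \<forall>k\<in>{..n}. close \<delta> n k r"
      by (rule finite_tolerances[OF finite_atMost]) (erule ex, rule mono)
    then obtain r where r: "r > 0" "\<forall>k\<in>{..n}. close \<delta> n k r" by blast
    then have "P \<delta> n (min r 1)"
      using mono[of _ r "min r 1"] by (auto simp: P_def)
    then show "\<exists>r. P \<delta> n r" by blast
  qed
  then obtain \<delta> where \<delta>: "\<And>n. P \<delta> n (\<delta> n)" by blast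
  have pos: "\<delta> n > 0" and le1: "\<delta> n \<le> 1" for n using \<delta>[of n] by (auto simp: P_def)
  have cl: "close \<delta> n k (\<delta> n)" if "k \<le> n" for k n using \<delta>[of n] that by (auto simp: P_def)
  define \<psi> where "\<psi> = (\<lambda>n. \<Psi> n (\<delta> n))"
  define t where "t = tower \<psi>"
  have Tt: "T \<delta> = t" by (simp add: T_def t_def \<psi>_def)
  have tc: "continuous_on UNIV (t k n)" and tinj: "inj (t k n)" for k n
    unfolding t_def using pos \<Psi>(1,2) by (auto simp: \<psi>_def intro: continuous_on_tower inj_tower)
  have inB: "(s, 0) \<in> B" "dist z (s, 0) \<le> 1 \<Longrightarrow> z \<in> B" if "s \<in> {0..1}" for s :: real and z
    using in_cball_5[OF that, of z] in_cball_5[OF that, of "(s,0)"] by (auto simp: B_def)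

  \<comment> \<open>Stage \<open>n\<close> seen in the coordinates of stage \<open>k\<close>, and its limit \<open>N k\<close>.\<close>
  define F where "F k n u = t k n (p n u, 0)" for k n u
  have step: "dist (F k (Suc (k + m)) u) (F k (k + m) u) \<le> \<delta> k / 2 ^ m" if u: "u \<in> X" for k m u
  proof -
    define n where "n = k + m"
    let ?z = "\<psi> n (p (Suc n) u, 0)" and ?z' = "(p n u, 0)"
    have d: "dist ?z ?z' \<le> \<delta> n"
      using \<Psi>(3)[OF pos p01[OF u]] pg[OF u, of n] by (simp add: \<psi>_def)
    have inz: "?z \<in> B" by (rule inB(2)[OF p01[OF u] order_trans[OF d le1]])
    have inz': "?z' \<in> B" by (rule inB(1)[OF p01[OF u]])
    have F: "F k (Suc n) u = t k n ?z" by (simp add: F_def t_def n_def)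
    show ?thesis
    proof (cases "m = 0")
      case True
      then show ?thesis using d F by (simp add: n_def F_def t_def tower_refl)
    next
      case False
      then have "dist (t k n ?z) (t k n ?z') \<le> \<delta> k / 2 ^ (n - k)"
        using cl[of k n] inz inz' d by (simp add: close_def Tt n_def)
      then show ?thesis using F by (simp add: n_def F_def)
    qed
  qed
  define lim_at where "lim_at k u l \<longleftrightarrow> (\<lambda>m. F k (k + m) u) \<longlonglongrightarrow> l \<and>
      (\<forall>m. dist (F k (k + m) u) l \<le> 2 * \<delta> k / 2 ^ m)" for k u l
  define N where "N k u = (SOME l. lim_at k u l)" for k u
  have "\<exists>l. lim_at k u l" if "u \<in> X" for k u
    unfolding lim_at_def by (rule geometric_steps_limit) (use step[OF that] in simp)
  then have "lim_at k u (N k u)" if "u \<in> X" for k u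
    unfolding N_def using someI_ex that by metis
  then have N: "u \<in> X \<Longrightarrow> (\<lambda>m. F k (k + m) u) \<longlonglongrightarrow> N k u"
      "u \<in> X \<Longrightarrow> dist (F k (k + m) u) (N k u) \<le> 2 * \<delta> k / 2 ^ m" for k m u
    unfolding lim_at_def by blast+
  have near: "dist (p k u, 0) (N k u) \<le> 2 * \<delta> k" if "u \<in> X" for k u
    using N(2)[OF that, of k 0] by (simp add: F_def t_def tower_refl)
  have NN: "N k u = t k n (N n u)" if "u \<in> X" "k \<le> n" for k n u
  proof (rule LIMSEQ_unique)
    have "(\<lambda>m. F k (m + k) u) \<longlonglongrightarrow> N k u"
      using N(1)[OF that(1), of k] by (simp add: add.commute)
    then have "(\<lambda>m. F k m u) \<longlonglongrightarrow> N k u" by (rule LIMSEQ_offset)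
    then show "(\<lambda>m. F k (m + n) u) \<longlonglongrightarrow> N k u" by (rule LIMSEQ_ignore_initial_segment)
    have "F k (m + n) u = t k n (F n (n + m) u)" for m
      using tower_trans[of k n "m + n" \<psi>] that(2) by (simp add: F_def t_def add.commute)
    moreover have "isCont (t k n) (N n u)" using tc continuous_on_eq_continuous_at open_UNIV by blast
    ultimately show "(\<lambda>m. F k (m + n) u) \<longlonglongrightarrow> t k n (N n u)"
      using isCont_tendsto_compose[OF _ N(1)[OF that(1)]] by simp
  qed
  have same: "u = v" if uv: "u \<in> X" "v \<in> X" and fst: "\<And>n. \<bar>p n u - p n v\<bar> \<le> 4 * \<delta> n" for u v
  proof (rule sep[OF uv])
    fix k
    have "\<bar>p k u - p k v\<bar> \<le> 1 / 2 ^ n" if "n \<ge> k" for n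
      using cl[OF that] uv fst by (simp add: close_def)
    moreover have "(\<lambda>n. 1 / 2 ^ n :: real) \<longlonglongrightarrow> 0"
      by (rule over_power_two_tendsto_0)
    ultimately have "\<bar>p k u - p k v\<bar> \<le> 0"
      by (intro LIMSEQ_le_const[of _ 0 "\<bar>p k u - p k v\<bar>"]) auto
    then show "p k u = p k v" by simp
  qed

  define \<nu> where "\<nu> u = to_plane (N 0 u)" for u
  have nu: "\<nu> u = to_plane (t 0 n (N n u))" if "u \<in> X" for n u
    using NN[OF that, of 0 n] by (simp add: \<nu>_def)
  have "continuous_on X (N 0)"
  proof (rule uniform_limit_theorem)
    show "uniform_limit X (F 0) (N 0) sequentially"
    proof (rule uniform_limitI)
      fix e :: real assume "e > 0"
      have lim0: "(\<lambda>n. 2 * \<delta> 0 / 2 ^ n) \<longlonglongrightarrow> 0"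
        by (rule over_power_two_tendsto_0)
      show "\<forall>\<^sub>F n in sequentially. \<forall>u\<in>X. dist (F 0 n u) (N 0 u) < e"
        using order_tendstoD(2)[OF lim0 \<open>e > 0\<close>]
        by eventually_elim (use N(2)[of _ 0] in \<open>fastforce intro: le_less_trans\<close>)
    qed
    show "\<forall>\<^sub>F n in sequentially. continuous_on X (F 0 n)"
      unfolding F_def by (intro always_eventually allI continuous_on_compose2[OF tc] continuous_intros pc) auto
  qed auto
  then have nuc: "continuous_on X \<nu>"
    unfolding \<nu>_def by (intro continuous_on_compose2[OF continuous_on_to_plane]) auto
  have nuinj: "inj_on \<nu> X"
  proof (rule inj_onI)
    fix u v assume uv: "u \<in> X" "v \<in> X" "\<nu> u = \<nu> v"
    show "u = v"
    proof (rule same[OF uv(1,2)])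
      fix n
      have eqN: "N n u = N n v" using uv nu[of _ n] inj_to_plane tinj by (metis injD)
      have "dist (p n u, 0::real) (p n v, 0) \<le> 4 * \<delta> n"
        using near[OF uv(1), of n] near[OF uv(2), of n] dist_triangle2[of "(p n u, 0)" "(p n v, 0)" "N n u"]
        unfolding eqN by linarith
      then show "\<bar>p n u - p n v\<bar> \<le> 4 * \<delta> n" by (simp add: dist_Pair_Pair dist_real_def)
    qed
  qed
  have emb: "planar_embedding X \<nu>"
    unfolding planar_embedding_def using homeomorphism_compact[OF X nuc refl nuinj] .

  have thin: "\<exists>(m::nat) (l :: nat \<Rightarrow> (real^2) set).
       (\<forall>i\<in>{1..m}. l i \<noteq> {} \<and> open (l i) \<and> connected (l i) \<and> bounded (l i) \<and> diameter (l i) < \<epsilon>) \<and>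
       (\<forall>i\<in>{1..m}. \<forall>j\<in>{1..m}. l i \<inter> l j \<noteq> {} \<longleftrightarrow> \<bar>int i - int j\<bar> \<le> 1) \<and>
       \<nu> ` X \<subseteq> (\<Union>i\<in>{1..m}. l i)" if e: "\<epsilon> > 0" for \<epsilon>
  proof -
    obtain n where n: "1 / 2 ^ n < \<epsilon>" using real_arch_pow_inv[OF e, of "1/2"] by (auto simp: power_one_over)
    define r where "r = \<delta> n"
    have r: "0 < r" "r \<le> 1" using pos le1 by (auto simp: r_def)
    define \<Phi> where "\<Phi> z = to_plane (t 0 n z)" for z
    have \<Phi>c: "continuous_on S \<Phi>" for S unfolding \<Phi>_def
      by (rule continuous_on_compose2[OF continuous_on_to_plane continuous_on_subset[OF tc]]) auto
    have \<Phi>i: "inj \<Phi>" using inj_to_plane tinj[of 0 n] unfolding \<Phi>_def inj_def by blast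
    \<comment> \<open>Intervals of length \<open>3/2 * r\<close> placed at distance \<open>r\<close>: neighbours overlap, all others are disjoint.
        The offset \<open>4\<close> and the \<open>7\<close> extra boxes leave room for the deviation \<open>2 * r\<close> at both ends.\<close>
    define I where "I i = {(real i - 4) * r <..< (real i - 4) * r + 3/2 * r}" for i
    define R where "R i = I i \<times> {-3*r<..<3*r}" for i
    define m where "m = nat \<lfloor>1 / r\<rfloor> + 7"
    have "of_int \<lfloor>1 / r\<rfloor> = real (nat \<lfloor>1 / r\<rfloor>)" using r by simp
    then have m1: "real m \<le> 1 / r + 7" "1 / r + 6 < real m" unfolding m_def by linarith+
    have m2: "real m * r \<le> 1 + 7 * r" "1 + 6 * r < real m * r"
      using mult_right_mono[OF m1(1), of r] mult_strict_right_mono[OF m1(2), of r] r by (auto simp: algebra_simps)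
    have RB: "R i \<subseteq> B" if "i \<in> {1..m}" for i
    proof
      fix z assume z: "z \<in> R i"
      have "real i * r \<le> real m * r" "1 * r \<le> real i * r"
        using that r by (auto intro!: mult_right_mono)
      moreover have "real i * r - 4 * r < fst z" "fst z < real i * r - 4 * r + 3/2 * r"
          "- 3 * r < snd z" "snd z < 3 * r"
        using z by (auto simp: R_def I_def left_diff_distrib)
      ultimately have "\<bar>fst z\<bar> \<le> 10" "\<bar>snd z\<bar> \<le> 10"
        using m2 r by linarith+
      then have "norm z \<le> 20" using norm_Pair_le[of "fst z" "snd z"] by simp
      then show "z \<in> B" by (simp add: B_def)
    qed
    have diam: "dist w w' \<le> 1 / 2 ^ n" if i: "i \<in> {1..m}" and w: "w \<in> \<Phi> ` R i" "w' \<in> \<Phi> ` R i" for i w w'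
    proof -
      obtain z z' where z: "w = \<Phi> z" "w' = \<Phi> z'" "z \<in> R i" "z' \<in> R i" using w by blast
      have "\<bar>fst z - fst z'\<bar> \<le> 2 * r" "\<bar>snd z - snd z'\<bar> \<le> 6 * r"
        using z by (auto simp: R_def I_def)
      moreover have "dist z z' \<le> \<bar>fst z - fst z'\<bar> + \<bar>snd z - snd z'\<bar>"
        using norm_Pair_le[of "fst z - fst z'" "snd z - snd z'"] by (simp add: dist_norm minus_prod_def)
      ultimately have "dist z z' \<le> 8 * r" by linarith
      then show ?thesis using cl[of 0 n] z RB[OF i] unfolding close_def Tt \<Phi>_def r_def by blast
    qed
    have "diameter (\<Phi> ` R i) \<le> 1 / 2 ^ n" if "i \<in> {1..m}" for i
      using diam[OF that] by (intro diameter_le) (auto simp: dist_norm)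
    then have "diameter (\<Phi> ` R i) < \<epsilon>" if "i \<in> {1..m}" for i
      using n that le_less_trans by blast
    moreover have "bounded (\<Phi> ` R i)" if "i \<in> {1..m}" for i
      unfolding bounded_two_points using diam[OF that] by blast
    moreover have "open (\<Phi> ` R i)" for i
    proof (rule invariance_of_domain_gen)
      show "open (R i)" by (simp add: R_def I_def open_Times)
      show "inj_on \<Phi> (R i)" using \<Phi>i by (rule inj_on_subset) simp
    qed (simp_all add: \<Phi>c)
    moreover have "connected (\<Phi> ` R i)" for i
      by (intro connected_continuous_image \<Phi>c) (simp add: R_def I_def connected_Times)
    moreover have "\<Phi> ` R i \<noteq> {}" for i using r by (simp add: R_def I_def)
    moreover have "\<Phi> ` R i \<inter> \<Phi> ` R j \<noteq> {} \<longleftrightarrow> \<bar>int i - int j\<bar> \<le> 1" for i j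
    proof -
      have "\<Phi> ` R i \<inter> \<Phi> ` R j = \<Phi> ` (R i \<inter> R j)" using \<Phi>i by (simp add: image_Int)
      moreover have "R i \<inter> R j = (I i \<inter> I j) \<times> {-3*r<..<3*r}" by (auto simp: R_def)
      moreover have "I i \<inter> I j \<noteq> {} \<longleftrightarrow> \<bar>int i - int j\<bar> \<le> 1"
      proof
        assume "I i \<inter> I j \<noteq> {}"
        then obtain s where "s \<in> I i" "s \<in> I j" by blast
        then have "real i * r < real j * r + 3/2 * r" "real j * r < real i * r + 3/2 * r"
          by (auto simp: I_def algebra_simps)
        then have "real i * r < (real j + 2) * r" "real j * r < (real i + 2) * r" 
          using r unfolding distrib_right by linarith+
        then have "real i < real j + 2" "real j < real i + 2" using r by auto
        then show "\<bar>int i - int j\<bar> \<le> 1" by linarith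
      next
        assume "\<bar>int i - int j\<bar> \<le> 1"
        then have ij: "real i \<le> real j + 1" "real j \<le> real i + 1" by linarith+
        have ij': "real i * r \<le> real j * r + r" "real j * r \<le> real i * r + r"
          using mult_right_mono[OF ij(1), of r] mult_right_mono[OF ij(2), of r] r by (auto simp: algebra_simps)
        have "max (real i * r) (real j * r) + r/4 - 4 * r \<in> I i \<inter> I j"
          using ij' r by (auto simp: I_def algebra_simps max_def)
        then show "I i \<inter> I j \<noteq> {}" by blast
      qed
      ultimately show ?thesis using r by simp
    qed
    moreover have "\<nu> ` X \<subseteq> (\<Union>i\<in>{1..m}. \<Phi> ` R i)"
    proof
      fix w assume "w \<in> \<nu> ` X"
      then obtain u where u: "u \<in> X" "w = \<nu> u" by blast
      define a b where "a = fst (N n u)" and "b = snd (N n u)"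
      have "dist (p n u, 0) (a, b) \<le> 2 * r" using near[OF u(1)] by (simp add: a_def b_def r_def)
      then have "\<bar>p n u - a\<bar> \<le> 2 * r" "\<bar>b\<bar> \<le> 2 * r"
        using norm_fst_le[of "p n u - a" "- b"] norm_snd_le[of "- b" "p n u - a"] by (auto simp: dist_norm)
      then have ab: "- 2 * r \<le> a" "a \<le> 1 + 2 * r" "- 3 * r < b" "b < 3 * r"
        using p01[OF u(1), of n] r by auto
      define i where "i = nat (\<lceil>a / r\<rceil> + 3)"
      have ar: "- 2 \<le> a / r" "a / r \<le> 1 / r + 2" using ab r by (auto simp: field_simps)
      have "\<lceil>a / r\<rceil> \<ge> -2" using ar(1) by (simp add: le_ceiling_iff)
      then have "\<lceil>a / r\<rceil> + 3 \<ge> 0" by linarith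
      then have "int i = \<lceil>a / r\<rceil> + 3" unfolding i_def by (rule nat_0_le)
      then have i: "real i = of_int \<lceil>a / r\<rceil> + 3" by linarith
      then have i2: "real i - 4 < a / r" "a / r \<le> real i - 3" by linarith+
      have "i \<ge> 1" "i \<le> m" using i i2 ar m1 \<open>\<lceil>a / r\<rceil> \<ge> -2\<close> by linarith+
      moreover have "(real i - 4) * r < a" "a \<le> (real i - 3) * r"
        using i2 r by (auto simp: field_simps)
      then have "a \<in> I i" using r by (auto simp: I_def algebra_simps)
      then have "N n u \<in> R i" using ab by (simp add: R_def a_def b_def mem_Times_iff)
      moreover have "w = \<Phi> (N n u)" using u nu by (simp add: \<Phi>_def)
      ultimately show "w \<in> (\<Union>i\<in>{1..m}. \<Phi> ` R i)" by auto
    qed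
    ultimately show ?thesis
      by (intro exI[of _ m] exI[of _ "\<lambda>i. \<Phi> ` R i"] conjI ballI) blast+
  qed

  have ray: "\<exists>c d. \<forall>n. d n > 0 \<and> (\<forall>u\<ge>0. t 0 n (y n, u) = (y 0, c n + d n * u)) \<and> c n \<le> c (Suc n)"
  proof -
    define cd where "cd = rec_nat (0, 1) (\<lambda>n (c, d). (c + d * C n (\<delta> n), d * D n (\<delta> n)))"
    define c d where "c n = fst (cd n)" and "d n = snd (cd n)" for n
    have cd0: "c 0 = 0" "d 0 = 1" by (simp_all add: c_def d_def cd_def)
    have cdS: "c (Suc n) = c n + d n * C n (\<delta> n)" "d (Suc n) = d n * D n (\<delta> n)" for n
      by (simp_all add: c_def d_def cd_def case_prod_unfold)
    have d: "d n > 0" for n by (induction n) (use cd0 cdS \<Psi>(5)[OF pos] in auto)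
    have "c n \<le> c (Suc n)" for n using cdS d[of n] \<Psi>(4)[OF pos] by simp
    moreover have "\<forall>u\<ge>0. t 0 n (y n, u) = (y 0, c n + d n * u)" for n
    proof (induction n)
      case 0
      then show ?case using cd0 by (simp add: t_def)
    next
      case (Suc n)
      have "t 0 (Suc n) (y (Suc n), u) = (y 0, c (Suc n) + d (Suc n) * u)" if "u \<ge> 0" for u
      proof -
        have "C n (\<delta> n) + D n (\<delta> n) * u \<ge> 0" using \<Psi>(4,5)[OF pos, of n] that by (simp add: less_imp_le)
        then show ?thesis using Suc.IH \<Psi>(6)[OF pos that, of n] cdS
          by (simp add: t_def \<psi>_def algebra_simps)
      qed
      then show ?case by blast
    qed
    ultimately show ?thesis using d by blast
  qed
  then obtain c d where d: "\<And>n. d n > 0" and ray: "\<And>n u. u \<ge> 0 \<Longrightarrow> t 0 n (y n, u) = (y 0, c n + d n * u)"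
    and "\<And>n. c n \<le> c (Suc n)" by blast
  then have "incseq c" by (auto intro: incseq_SucI)
  have Fx: "F 0 n x = (y 0, c n)" for n using ray[of 0 n] by (simp add: F_def y_def)
  have limx: "(\<lambda>n. (y 0, c n)) \<longlonglongrightarrow> N 0 x" using N(1)[OF x, of 0] Fx by simp
  define h where "h = snd (N 0 x)"
  have "c \<longlonglongrightarrow> h" using tendsto_snd[OF limx] by (simp add: h_def)
  then have ch: "c n \<le> h" for n using \<open>incseq c\<close> incseq_le by blast
  have Nx: "N 0 x = (y 0, h)"
    using LIMSEQ_unique[OF tendsto_fst[OF limx], of "y 0"] by (simp add: h_def prod_eq_iff)
  \<comment> \<open>Any vertical segment that starts at the image of \<open>x\<close> and goes up is an access arc.\<close>
  define A where "A = (\<lambda>s. to_plane (y 0, h + s)) ` {0..1}"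
  have "A homeomorphic {0..1::real}"
  proof -
    have "continuous_on {0..1::real} (\<lambda>s. to_plane (y 0, h + s))"
      by (rule continuous_on_compose2[OF continuous_on_to_plane[of UNIV]]) (auto intro!: continuous_intros)
    moreover have "inj_on (\<lambda>s. to_plane (y 0, h + s)) {0..1}"
    proof (rule inj_onI)
      fix s s' assume "to_plane (y 0, h + s) = to_plane (y 0, h + s')"
      then have "(y 0, h + s) = (y 0, h + s')" by (rule injD[OF inj_to_plane])
      then show "s = s'" by simp
    qed
    ultimately have "{0..1::real} homeomorphic A"
      unfolding A_def by (intro homeomorphic_compact) auto
    then show ?thesis by (rule homeomorphic_sym[THEN iffD1])
  qed
  moreover have "A \<inter> \<nu> ` X = {\<nu> x}"
  proof
    show "{\<nu> x} \<subseteq> A \<inter> \<nu> ` X" using x Nx by (force simp: A_def \<nu>_def)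
    show "A \<inter> \<nu> ` X \<subseteq> {\<nu> x}"
    proof
      fix w assume "w \<in> A \<inter> \<nu> ` X"
      then obtain s v where sv: "s \<in> {0..1}" "w = to_plane (y 0, h + s)" "v \<in> X" "w = \<nu> v"
        by (auto simp: A_def)
      have "v = x"
      proof (rule same[OF sv(3) x])
        fix n
        define u where "u = (h + s - c n) / d n"
        have "u \<ge> 0" using sv(1) ch[of n] d[of n] by (simp add: u_def)
        then have "t 0 n (y n, u) = (y 0, h + s)" using ray[of u n] d[of n] by (simp add: u_def)
        moreover have "t 0 n (N n v) = (y 0, h + s)"
          using sv nu[OF sv(3), of n] inj_to_plane by (metis injD)
        ultimately have "N n v = (y n, u)" using tinj by (metis injD)
        then have "dist (p n v, 0) (y n, u) \<le> 2 * \<delta> n" using near[OF sv(3), of n] by simp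
        then have "\<bar>p n v - y n\<bar> \<le> 2 * \<delta> n"
          using norm_fst_le[of "p n v - y n" "- u"] by (simp add: dist_norm)
        then show "\<bar>p n v - p n x\<bar> \<le> 4 * \<delta> n" using pos[of n] by (simp add: y_def)
      qed
      then show "w \<in> {\<nu> x}" using sv by simp
    qed
  qed
  ultimately have "accessible (\<nu> ` X) (\<nu> x)" using x unfolding accessible_def by blast
  moreover have "thin_planar_embedding X \<nu>"
    unfolding thin_planar_embedding_def using emb thin by blast
  ultimately show ?thesis by blast
qed

section \<open>Minc's map\<close>

text \<open>
  One closed formula, with one hinge at each breakpoint; continuity and the symmetry are then
  immediate.
\<close>

lemma f_M_eq: "f_M t = 3 * t - 9 * max 0 (t - 1/3) + 9 * max 0 (t - 4/9) - 9 * max 0 (t - 5/9) + 9 * max 0 (t - 2/3)"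
  by (simp add: f_M_def line_thru_def max_def algebra_simps)

lemma f_M_branch:
  "t \<le> 1/3 \<Longrightarrow> f_M t = 3 * t"
  "1/3 \<le> t \<Longrightarrow> t \<le> 4/9 \<Longrightarrow> f_M t = 3 - 6 * t"
  "4/9 \<le> t \<Longrightarrow> t \<le> 5/9 \<Longrightarrow> f_M t = 3 * t - 1"
  "5/9 \<le> t \<Longrightarrow> t \<le> 2/3 \<Longrightarrow> f_M t = 4 - 6 * t"
  "2/3 \<le> t \<Longrightarrow> f_M t = 3 * t - 2"
  by (simp_all add: f_M_eq max_def)

lemma continuous_on_f_M: "continuous_on S f_M"
  unfolding f_M_eq[abs_def] by (intro continuous_intros)

lemma f_M_range: "t \<in> {0..1} \<Longrightarrow> f_M t \<in> {0..1}"
  by (auto simp: f_M_eq max_def)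

lemma f_M_symmetric: "f_M (1 - t) = 1 - f_M t"
  by (simp add: f_M_eq max_def)

text \<open>
  Only the part of the graph to the right of the zero \<open>t0\<close> is of concern. The map factors as
  \<open>V \<circ> b\<close> with \<open>V w = \<bar>2 * w - 1\<bar>\<close>, where \<open>b\<close> unfolds \<open>g\<close> at \<open>t0\<close>: everything to the left of \<open>t0\<close> is put on the
  left arm of \<open>V\<close>, out of the way of \<open>y\<close>. The point \<open>b y\<close> is on the right arm, which is exposed for \<open>V\<close>.
\<close>

lemma plane_lift_above_zero:
  assumes g: "continuous_on {0..1} g" "g ` {0..1} \<subseteq> {0..1}"
    and y: "t0 \<in> {0..1}" "y \<in> {0..1}" "t0 < y" and zero: "g t0 = 0"
    and less: "\<And>t. t0 \<le> t \<Longrightarrow> t < y \<Longrightarrow> g t < g y"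
  shows "plane_lift g y"
proof -
  define b where "b t = (if t \<le> t0 then (1 - g t) / 2 else (1 + g t) / 2)" for t
  define V where "V w = \<bar>2 * w - 1\<bar>" for w :: real
  have g01: "0 \<le> g t" "g t \<le> 1" if "t \<in> {0..1}" for t using g(2) that by (auto simp: image_subset_iff)
  have "b t \<in> {0..1}" if "t \<in> {0..1}" for t using g01[OF that] by (simp add: b_def)
  then have b01: "b ` {0..1} \<subseteq> {0..1}" by blast
  have "continuous_on ({0..t0} \<union> {t0..1}) b"
    unfolding b_def
    by (rule continuous_on_If)
      (use zero y in \<open>auto intro!: continuous_intros intro: continuous_on_subset[OF g(1)]\<close>)
  moreover have "{0..t0} \<union> {t0..1} = {0..1}" using y by auto
  ultimately have bc: "continuous_on {0..1} b" by simp
  have gy: "g y > 0" using less[of t0] y zero by simp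
  have "plane_lift b y"
  proof (rule plane_lift_below_left[OF bc b01 y(2)])
    fix t assume t: "t \<in> {0..1}" "t < y"
    show "b t < b y"
    proof (cases "t \<le> t0")
      case True
      then show ?thesis using y gy g01(1)[OF t(1)] by (simp add: b_def)
    next
      case False
      then show ?thesis using y less[of t] t by (simp add: b_def)
    qed
  qed
  moreover have "plane_lift V (b y)"
  proof (rule plane_lift_above_right)
    show "continuous_on {0..1} V" unfolding V_def by (intro continuous_intros)
    show "b y \<in> {0..1}" using b01 y by blast
    show "V t > V (b y)" if "t > b y" for t using that y gy by (simp add: V_def b_def)
  qed
  ultimately have "plane_lift (V \<circ> b) y" using plane_lift_comp b01 by blast
  moreover have "(V \<circ> b) t = g t" if "t \<in> {0..1}" for t
    using g01[OF that] by (simp add: V_def b_def abs_if field_simps)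
  ultimately show ?thesis by (rule plane_lift_cong[OF _ y(2)])
qed

lemma plane_lift_below_one:
  assumes g: "continuous_on {0..1} g" "g ` {0..1} \<subseteq> {0..1}"
    and y: "t0 \<in> {0..1}" "y \<in> {0..1}" "t0 < y" and one: "g t0 = 1"
    and less: "\<And>t. t0 \<le> t \<Longrightarrow> t < y \<Longrightarrow> g y < g t"
  shows "plane_lift g y"
proof -
  have "plane_lift (\<lambda>t. 1 - g t) y"
    by (rule plane_lift_above_zero[of _ t0])
      (use assms in \<open>auto intro!: continuous_intros\<close>)
  then have "plane_lift ((\<lambda>t. 1 - t) \<circ> (\<lambda>t. 1 - g t)) y"
    by (rule plane_lift_comp) (use g(2) plane_lift_reflection in auto)
  then show ?thesis by (simp add: comp_def)
qed

text \<open>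
  The middle branch of \<open>f_M\<close> rises from \<open>1/3\<close> to \<open>2/3\<close> between two branches that fall across the whole
  interval \<open>{1/3..2/3}\<close>. In the plane the two neighbours shield it from both sides, and the criteria
  above do not reach its points.
\<close>

definition middle :: "real set" where "middle = {4/9<..<5/9}"

text \<open>
  On the two outer branches the point is extremal for its level. On the second branch unfolding
  \<open>f_M\<close> at its peak \<open>1/3\<close> removes the first branch, and the fourth is symmetric to the second.
\<close>

lemma plane_lift_f_M:
  assumes y: "y \<in> {0..1}" "y \<notin> middle"
  shows "plane_lift f_M y"
proof -
  have r: "f_M ` {0..1} \<subseteq> {0..1}" using f_M_range by blast
  have second: "plane_lift f_M y" if "1/3 < y" "y \<le> 4/9" for y
    by (rule plane_lift_below_one[of _ "1/3"])
      (use that r continuous_on_f_M in \<open>auto simp: f_M_branch\<close>)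
  consider "y \<le> 1/3" | "1/3 < y" "y \<le> 4/9" | "5/9 \<le> y" "y < 2/3" | "2/3 \<le> y"
    using y by (fastforce simp: middle_def)
  then show ?thesis
  proof cases
    case 1
    then show ?thesis
      by (intro plane_lift_below_left continuous_on_f_M r y) (simp add: f_M_branch)
  next
    case 2
    then show ?thesis by (rule second)
  next
    case 3
    then have "plane_lift f_M (1 - y)" by (intro second) auto
    then have "plane_lift (\<lambda>t. 1 - f_M (1 - t)) (1 - (1 - y))" by (rule plane_lift_conjugate[OF _ r])
    then show ?thesis by (simp add: f_M_symmetric)
  next
    case 4
    then show ?thesis
      by (intro plane_lift_above_right continuous_on_f_M y) (simp add: f_M_branch)
  qed
qed

text \<open>
  This map solves \<open>f_M \<circ> s_M = f_M \<circ> f_M\<close> on the unit interval, so it may replace the inner \<open>f_M\<close>. On the middle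
  branch it is \<open>f_M\<close>; elsewhere \<open>f_M \<circ> f_M\<close> is lifted through the first branch of \<open>f_M\<close> on the left and
  through the last branch on the right. The values therefore stay in \<open>{0..1/3}\<close> on the left
  and in \<open>{2/3..1}\<close> on the right, and the middle branch is no longer shielded.
\<close>

definition s_M :: "real \<Rightarrow> real" where
  "s_M t = (if t \<le> 4/9 then f_M (f_M t) / 3 else if t \<le> 5/9 then f_M t else (f_M (f_M t) + 2) / 3)"

lemma f_M_s_M:
  assumes "t \<in> {0..1}"
  shows "f_M (s_M t) = f_M (f_M t)"
proof -
  have v: "0 \<le> f_M (f_M t)" "f_M (f_M t) \<le> 1" using f_M_range[OF f_M_range[OF assms]] by auto
  have "f_M (f_M (f_M t) / 3) = f_M (f_M t)" "f_M ((f_M (f_M t) + 2) / 3) = f_M (f_M t)"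
    using v by (subst f_M_branch; simp add: field_simps)+
  then show ?thesis by (simp add: s_M_def)
qed

lemma s_M_range: "t \<in> {0..1} \<Longrightarrow> s_M t \<in> {0..1}"
  using f_M_range[of t] f_M_range[of "f_M t"] by (auto simp: s_M_def)

lemma s_M_middle: "t \<in> middle \<Longrightarrow> s_M t = f_M t"
  by (simp add: s_M_def middle_def)

lemma f_M_grid: "f_M (1/3) = 1" "f_M (4/9) = 1/3" "f_M (5/9) = 2/3" "f_M (2/3) = 0"
  by (simp_all add: f_M_branch)

lemma continuous_on_s_M: "continuous_on S s_M"
proof -
  have s_M: "s_M = (\<lambda>t. f_M (f_M (min t (4/9))) / 3 + f_M (max (4/9) (min t (5/9)))
      + f_M (f_M (max t (5/9))) / 3 - 1/3)"
  proof
    fix t :: real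
    consider "t < 4/9" | "t = 4/9" | "4/9 < t" "t < 5/9" | "t = 5/9" | "5/9 < t" by linarith
    then show "s_M t = f_M (f_M (min t (4/9))) / 3 + f_M (max (4/9) (min t (5/9)))
        + f_M (f_M (max t (5/9))) / 3 - 1/3"
    proof cases
      case 2
      show ?thesis unfolding 2 by (simp add: s_M_def f_M_grid)
    next
      case 4
      show ?thesis unfolding 4 by (simp add: s_M_def f_M_grid)
    qed (simp_all add: s_M_def f_M_grid)
  qed
  have c: "continuous_on S (\<lambda>t. f_M (h t))" if "continuous_on S h" for h
    by (rule continuous_on_compose2[OF continuous_on_f_M that subset_UNIV])
  show ?thesis unfolding s_M by (intro continuous_intros c) auto
qed

lemma plane_lift_s_M:
  assumes "y \<in> middle"
  shows "plane_lift s_M y"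
proof (rule plane_lift_above_right[OF continuous_on_s_M])
  show "y \<in> {0..1}" using assms by (simp add: middle_def)
  fix t assume t: "t \<in> {0..1}" "t > y"
  have "f_M (f_M t) \<ge> 0" using f_M_range[OF f_M_range[OF t(1)]] by simp
  then show "s_M t > s_M y" using assms t by (auto simp: s_M_def middle_def f_M_branch)
qed

text \<open>
  Just to the left of \<open>y\<close> the graph comes up from height \<open>0\<close> and stays below the height of \<open>y\<close>, so it
  is enough to unfold it at that zero. The zero is at \<open>25/54\<close>, since \<open>f_M (25/54) = 7/18\<close> and
  \<open>s_M (7/18) = 0\<close>.
\<close>

lemma plane_lift_s_M_f_M:
  assumes y: "y \<in> middle" "f_M y \<in> middle"
  shows "plane_lift (s_M \<circ> f_M) y"
proof (rule plane_lift_above_zero[of _ "25/54"])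
  show "continuous_on {0..1} (s_M \<circ> f_M)"
    unfolding comp_def by (rule continuous_on_compose2[OF continuous_on_s_M continuous_on_f_M subset_UNIV])
  show "(s_M \<circ> f_M) ` {0..1} \<subseteq> {0..1}" using s_M_range f_M_range by (simp add: image_subset_iff)
  have fy: "f_M y = 3 * y - 1" using y by (simp add: middle_def f_M_branch)
  then show "y \<in> {0..1}" "25/54 < y" using y by (auto simp: middle_def)
  show "(25/54 :: real) \<in> {0..1}" by simp
  show "(s_M \<circ> f_M) (25/54) = 0" by (simp add: s_M_def f_M_branch)
  fix t assume t: "25/54 \<le> t" "t < y"
  then have ft: "f_M t = 3 * t - 1" using y by (simp add: middle_def f_M_branch)
  have t01: "f_M t \<in> {0..1}" using t y by (intro f_M_range) (simp add: middle_def)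
  have "s_M (f_M t) < s_M (f_M y)"
  proof (cases "f_M t \<le> 4/9")
    case True
    then have "s_M (f_M t) \<le> 1/3" using f_M_range[OF f_M_range[OF t01]] by (simp add: s_M_def)
    also have "1/3 < s_M (f_M y)" using y(2) by (simp add: s_M_def middle_def f_M_branch)
    finally show ?thesis .
  next
    case False
    then have "f_M t \<in> middle" using ft fy t y by (simp add: middle_def)
    then show ?thesis using y(2) ft fy t by (simp add: s_M_def middle_def f_M_branch)
  qed
  then show "(s_M \<circ> f_M) t < (s_M \<circ> f_M) y" by simp
qed

lemma inverse_limit_step: "\<xi> \<in> X_M \<Longrightarrow> f_M (\<xi> (Suc n)) = \<xi> n"
  by (simp add: X_M_def inverse_limit_def)

lemma inverse_limit_range: "\<xi> \<in> X_M \<Longrightarrow> \<xi> n \<in> {0..1}"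
  by (simp add: X_M_def inverse_limit_def)

lemma inverse_limit_iterate: "\<xi> \<in> X_M \<Longrightarrow> (f_M ^^ k) (\<xi> (n + k)) = \<xi> n"
  by (induction k) (simp_all add: funpow_swap1 inverse_limit_step)

lemma compact_X_M: "compact X_M"
proof -
  have c: "continuous_on UNIV (\<lambda>\<xi>::nat \<Rightarrow> real. \<xi> i)" for i
    by (rule continuous_on_product_coordinates)
  have "compactin (product_topology (\<lambda>_::nat. euclidean::real topology) UNIV) (PiE UNIV (\<lambda>_. {0..1}))"
    unfolding compactin_PiE by simp
  then have cube: "compact (PiE UNIV (\<lambda>_. {0..1}) :: (nat \<Rightarrow> real) set)"
    by (simp add: euclidean_product_topology)
  have closed: "closed {\<xi>. \<forall>i::nat. i \<ge> 1 \<longrightarrow> f_M (\<xi> i) = \<xi> (i - 1)}"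
    by (intro closed_Collect_all closed_Collect_imp open_Collect_const closed_Collect_eq c
        continuous_on_compose2[OF continuous_on_f_M c]) auto
  have "X_M = PiE UNIV (\<lambda>_. {0..1}) \<inter> {\<xi>. \<forall>i::nat. i \<ge> 1 \<longrightarrow> f_M (\<xi> i) = \<xi> (i - 1)}"
    by (auto simp: X_M_def inverse_limit_def PiE_UNIV_domain)
  then show ?thesis using compact_Int_closed[OF cube closed] by (simp only:)
qed

lemma funpow_s_M_range: "t \<in> {0..1} \<Longrightarrow> (s_M ^^ k) t \<in> {0..1}"
  by (induction k) (simp_all only: funpow.simps id_apply comp_apply s_M_range)

lemma f_M_funpow_s_M: "t \<in> {0..1} \<Longrightarrow> f_M ((s_M ^^ k) t) = (f_M ^^ Suc k) t"
proof (induction k arbitrary: t)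
  case (Suc k)
  have "f_M ((s_M ^^ Suc k) t) = (f_M ^^ Suc k) (s_M t)"
    using Suc.IH[OF s_M_range[OF Suc.prems]] by (simp add: funpow_swap1)
  also have "\<dots> = (f_M ^^ k) (f_M (f_M t))" using f_M_s_M[OF Suc.prems] by (simp add: funpow_swap1)
  finally show ?case by (simp add: funpow_swap1)
qed simp

lemma continuous_on_funpow_s_M: "continuous_on S (s_M ^^ k)"
proof (induction k)
  case (Suc k)
  show ?case unfolding funpow.simps comp_def
    by (rule continuous_on_compose2[OF continuous_on_s_M Suc subset_UNIV])
qed (simp add: id_def)

lemma continuous_on_coordinate: "continuous_on X_M (\<lambda>\<xi>. \<xi> n)"
  by (rule continuous_on_subset[OF continuous_on_product_coordinates]) simp

text \<open>
  The bonding map at stage \<open>n\<close> is \<open>s_M\<close> if the next coordinate of \<open>x\<close> is on the middle branch, and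
  \<open>f_M\<close> otherwise. Every run of copies of \<open>s_M\<close> ends, after \<open>d n\<close> steps, at a genuine coordinate, so the
  projections \<open>p n\<close> can be written down; since \<open>f_M \<circ> s_M\<close> iterates like \<open>f_M\<close>, applying \<open>f_M\<close> to
  \<open>p (n + 1)\<close> recovers the coordinate \<open>n\<close>. Along \<open>x\<close> itself nothing has changed, because
  \<open>s_M = f_M\<close> on the middle branch.
\<close>

lemma accessible_frequently_outside_middle:
  assumes x: "x \<in> X_M" and inf: "\<And>n. \<exists>k. x (Suc (n + k)) \<notin> middle"
  shows "\<exists>\<nu>. thin_planar_embedding X_M \<nu> \<and> accessible (\<nu> ` X_M) (\<nu> x)"
proof -
  define d where "d n = (LEAST k. x (Suc (n + k)) \<notin> middle)" for n
  define p where "p n \<xi> = (s_M ^^ d n) (\<xi> (n + d n))" for n and \<xi> :: "nat \<Rightarrow> real"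
  define g where "g n = (if x (Suc n) \<in> middle then s_M else f_M)" for n
  have f_p: "f_M (p (Suc n) u) = u n" if u: "u \<in> X_M" for n u
  proof -
    have "f_M (p (Suc n) u) = (f_M ^^ Suc (d (Suc n))) (u (n + Suc (d (Suc n))))"
      unfolding p_def using f_M_funpow_s_M[OF inverse_limit_range[OF u]] by simp
    then show ?thesis using inverse_limit_iterate[OF u, of "Suc (d (Suc n))" n] by (simp only:)
  qed
  have d_outside: "d n = 0" if "x (Suc n) \<notin> middle" for n
    unfolding d_def using that by (intro Least_eq_0) simp
  have d_inside: "d n = Suc (d (Suc n))" if "x (Suc n) \<in> middle" for n
  proof -
    obtain k where k: "x (Suc (n + k)) \<notin> middle" using inf by blast
    have "(LEAST k. x (Suc (n + k)) \<notin> middle) = Suc (LEAST k. x (Suc (n + Suc k)) \<notin> middle)"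
      by (rule Least_Suc[of "\<lambda>k. x (Suc (n + k)) \<notin> middle", OF k]) (use that in simp)
    then show ?thesis by (simp add: d_def)
  qed
  have pg: "p n u = g n (p (Suc n) u)" if u: "u \<in> X_M" for n u
  proof (cases "x (Suc n) \<in> middle")
    case True
    then show ?thesis by (simp add: p_def g_def d_inside)
  next
    case False
    then show ?thesis using f_p[OF u, of n] by (simp add: g_def p_def[of n] d_outside)
  qed
  have run: "(\<forall>i<k. x (Suc (n + i)) \<in> middle) \<Longrightarrow> (s_M ^^ k) (x (n + k)) = x n" for n k
  proof (induction k)
    case (Suc k)
    then show ?case
      using s_M_middle[of "x (Suc (n + k))"] inverse_limit_step[OF x, of "n + k"] by (simp add: funpow_swap1)
  qed simp
  have px: "p n x = x n" for n
    unfolding p_def by (rule run) (auto simp: d_def dest: not_less_Least)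
  show ?thesis
  proof (rule accessible_thin_embedding[OF compact_X_M x, of p g])
    show "continuous_on X_M (p n)" for n unfolding p_def
      by (rule continuous_on_compose2[OF continuous_on_funpow_s_M continuous_on_coordinate subset_UNIV])
    show "p n u \<in> {0..1}" if "u \<in> X_M" for n u
      unfolding p_def by (intro funpow_s_M_range inverse_limit_range that)
    show "continuous_on {0..1} (g n)" for n by (simp add: g_def continuous_on_s_M continuous_on_f_M)
    show "p n u = g n (p (Suc n) u)" if "u \<in> X_M" for n u by (rule pg[OF that])
    show "u = v" if uv: "u \<in> X_M" "v \<in> X_M" and eq: "\<And>n. p n u = p n v" for u v
    proof
      fix n
      show "u n = v n" using f_p[OF uv(1), of n] f_p[OF uv(2), of n] eq[of "Suc n"] by simp
    qed
    show "plane_lift (g n) (p (Suc n) x)" for n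
      unfolding px g_def using plane_lift_s_M plane_lift_f_M[OF inverse_limit_range[OF x]] by simp
  qed
qed

text \<open>
  Here the run of copies of \<open>s_M\<close> would never end. Instead every second copy of \<open>f_M\<close> is replaced: the
  system \<open>f_M, s_M, f_M, s_M, \<dots>\<close> still has the same limit, and grouping it as copies of \<open>s_M \<circ> f_M\<close>
  puts the fold of \<open>s_M\<close> after the zigzag of \<open>f_M\<close>, which exposes the late coordinates of \<open>x\<close>.
\<close>

lemma accessible_eventually_inside_middle:
  assumes x: "x \<in> X_M" and inside: "\<And>n. n > N \<Longrightarrow> x n \<in> middle"
  shows "\<exists>\<nu>. thin_planar_embedding X_M \<nu> \<and> accessible (\<nu> ` X_M) (\<nu> x)"
proof -
  define m where "m n = N + 2 * n + 2" for n
  define p where "p n \<xi> = s_M (\<xi> (m n))" for n and \<xi> :: "nat \<Rightarrow> real"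
  have ff: "f_M (f_M (u (n + 2))) = u n" if "u \<in> X_M" for n u
    using inverse_limit_step[OF that] by simp
  have f_p: "f_M (p n u) = u (N + 2 * n)" if u: "u \<in> X_M" for n u
    using f_M_s_M[OF inverse_limit_range[OF u]] ff[OF u, of "N + 2 * n"] by (simp add: p_def m_def)
  show ?thesis
  proof (rule accessible_thin_embedding[OF compact_X_M x, of p "\<lambda>n. s_M \<circ> f_M"])
    show "continuous_on X_M (p n)" for n unfolding p_def
      by (rule continuous_on_compose2[OF continuous_on_s_M continuous_on_coordinate subset_UNIV])
    show "p n u \<in> {0..1}" if "u \<in> X_M" for n u
      unfolding p_def by (intro s_M_range inverse_limit_range that)
    show "continuous_on {0..1} (s_M \<circ> f_M)" unfolding comp_def
      by (rule continuous_on_compose2[OF continuous_on_s_M continuous_on_f_M subset_UNIV])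
    show "p n u = (s_M \<circ> f_M) (p (Suc n) u)" if "u \<in> X_M" for n u
      using f_p[OF that, of "Suc n"] by (simp add: p_def m_def)
    show "u = v" if uv: "u \<in> X_M" "v \<in> X_M" and eq: "\<And>n. p n u = p n v" for u v
    proof
      fix n
      have sum: "n + (N + n) = N + 2 * n" by simp
      have "u (n + (N + n)) = v (n + (N + n))"
        unfolding sum using f_p[OF uv(1), of n] f_p[OF uv(2), of n] eq[of n] by simp
      then show "u n = v n"
        using inverse_limit_iterate[OF uv(1), of "N + n" n] inverse_limit_iterate[OF uv(2), of "N + n" n] by simp
    qed
    show "plane_lift (s_M \<circ> f_M) (p (Suc n) x)" for n
    proof -
      have "x (m (Suc n)) \<in> middle" by (rule inside) (simp add: m_def)
      then have p: "p (Suc n) x = x (N + 2 * n + 3)"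
        using inverse_limit_step[OF x, of "N + 2 * n + 3"] by (simp add: p_def m_def s_M_middle eval_nat_numeral)
      have "f_M (p (Suc n) x) = x (N + 2 * n + 2)"
        using inverse_limit_step[OF x, of "N + 2 * n + 2"] unfolding p by (simp add: eval_nat_numeral)
      then show ?thesis using inside by (intro plane_lift_s_M_f_M) (simp_all add: p)
    qed
  qed
qed

theorem theorem4p3:
  shows "\<forall>x\<in>X_M. \<exists>\<nu>. thin_planar_embedding X_M \<nu> \<and> accessible (\<nu> ` X_M) (\<nu> x)"
proof
  fix x assume x: "x \<in> X_M"
  show "\<exists>\<nu>. thin_planar_embedding X_M \<nu> \<and> accessible (\<nu> ` X_M) (\<nu> x)"
  proof (cases "\<exists>N. \<forall>n>N. x n \<in> middle")
    case True
    then show ?thesis using accessible_eventually_inside_middle[OF x] by blast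
  next
    case False
    have "\<exists>k. x (Suc (n + k)) \<notin> middle" for n
    proof -
      obtain m where "m > n" "x m \<notin> middle" using False by blast
      then show ?thesis using less_iff_Suc_add[of n m] by auto
    qed
    then show ?thesis by (rule accessible_frequently_outside_middle[OF x])
  qed
qed

end
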